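(* Let $k$ be a positive integer and let $G$ be a finite tree with at least one edge. If $d(G)\leq k$, then $G$ is isomorphic to a subgraph (not necessarily induced) of the infinite $k$-dimensional rectangular grid $Q_k$.
   Context: A vertex labeling of a graph $G$ is an injective map $f:V(G)\to\mathbb{Z}$. It induces the edge labeling $f^-:E(G)\to\mathbb{Z}$, $f^-(uv)=|f(u)-f(v)|$, and $|f^-|$ denotes the number of distinct values $f^-$ takes on $E(G)$. The difference index $d(G)$ is the minimum positive integer $k$ such that there exists a vertex labeling $f$ of $G$ with $|f^-|=k$. Let $\mathbf{e}_1,\dotsc,\mathbf{e}_k$ be the standard basis vectors of $\mathbb{Z}^k$. The infinite $k$-dimensional rectangular grid $Q_k$ is the Cayley graph of $\mathbb{Z}^k$ with generating set $S=\{\pm\mathbf{e}_1,\dotsc,\pm\mathbf{e}_k\}$: its vertex set is $\mathbb{Z}^k$, and $\mathbf{x},\mathbf{x}'\in\mathbb{Z}^k$ are adjacent if and only if $\mathbf{x}-\mathbf{x}'\in S$. *)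

theory Defs
  imports "Graph_Theory.Graph_Theory"
begin

text \<open>
  Finite simple undirected graphs are those satisfying the locale \<^locale>\<open>graph\<close>: finite
  loopfree symmetric digraphs without parallel arcs, where an undirected edge is a pair of
  opposite arcs.
\<close>

text \<open>
  The constant \<^const>\<open>tree\<close> is a notion for digraphs and excludes every symmetric graph with an
  edge: following an edge forth and back is a \<^const>\<open>pre_digraph.cycle\<close> of length 2. The cycles
  of an undirected simple graph are those of length at least 3.
\<close>

definition undirected_tree :: "('a, 'b) pre_digraph \<Rightarrow> bool" where
  "undirected_tree G \<longleftrightarrow>
     graph G \<and> connected G \<and> \<not> (\<exists>p. pre_digraph.cycle G p \<and> 3 \<le> length p)"

definition vertex_labeling :: "('a, 'b) pre_digraph \<Rightarrow> ('a \<Rightarrow> int) \<Rightarrow> bool" where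
  "vertex_labeling G f \<longleftrightarrow> inj_on f (verts G)"

text \<open>The two opposite arcs of an undirected edge receive the same label.\<close>

definition edge_labeling :: "('a, 'b) pre_digraph \<Rightarrow> ('a \<Rightarrow> int) \<Rightarrow> 'b \<Rightarrow> int" where
  "edge_labeling G f e = \<bar>f (tail G e) - f (head G e)\<bar>"

text \<open>
  For a finite graph with at least one edge the minimum below is over a nonempty set; for an
  edgeless graph the value is unspecified.
\<close>

definition difference_index :: "('a, 'b) pre_digraph \<Rightarrow> nat" where
  "difference_index G =
     (LEAST k. 0 < k \<and> (\<exists>f. vertex_labeling G f \<and> card (edge_labeling G f ` arcs G) = k))"

text \<open>
  Vectors in the \<open>k\<close>-dimensional integer lattice are represented by the functions
  \<^typ>\<open>nat \<Rightarrow> int\<close> that vanish outside the index set \<^term>\<open>{..<k}\<close>; subtraction and negation are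
  pointwise.
\<close>

definition unit_vec :: "nat \<Rightarrow> nat \<Rightarrow> int" where
  "unit_vec i = (\<lambda>j. if j = i then 1 else 0)"

definition lattice :: "nat \<Rightarrow> (nat \<Rightarrow> int) set" where
  "lattice k = {x. \<forall>i\<ge>k. x i = 0}"

definition grid_generators :: "nat \<Rightarrow> (nat \<Rightarrow> int) set" where
  "grid_generators k = unit_vec ` {..<k} \<union> (\<lambda>i. - unit_vec i) ` {..<k}"

definition grid :: "nat \<Rightarrow> (nat \<Rightarrow> int) pair_pre_digraph" where
  "grid k = \<lparr> pverts = lattice k,
     parcs = {(x, x'). x \<in> lattice k \<and> x' \<in> lattice k \<and> x - x' \<in> grid_generators k} \<rparr>"

lemma uminus_grid_generators: "s \<in> grid_generators k \<Longrightarrow> - s \<in> grid_generators k"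
  by (auto simp: grid_generators_def fun_eq_iff image_iff)

lemma zero_notin_grid_generators: "(\<lambda>_. 0) \<notin> grid_generators k"
  by (auto simp: grid_generators_def unit_vec_def fun_eq_iff split: if_splits)

lemma pair_bidirected_digraph_grid: "pair_bidirected_digraph (grid k)"
proof
  show "symmetric (with_proj (grid k))"
    unfolding symmetric_def
  proof (rule symI)
    fix x y assume "(x, y) \<in> arcs_ends (with_proj (grid k))"
    then have "x \<in> lattice k" "y \<in> lattice k" "x - y \<in> grid_generators k"
      by (auto simp: grid_def)
    moreover have "y - x = - (x - y)"
      by (simp add: fun_eq_iff)
    ultimately show "(y, x) \<in> arcs_ends (with_proj (grid k))"
      using uminus_grid_generators[of "x - y" k] by (simp add: grid_def)
  qed
next
  fix e assume "e \<in> parcs (grid k)"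
  then have "fst e - snd e \<in> grid_generators k"
    by (auto simp: grid_def)
  moreover have "x - x = (\<lambda>_. 0)" for x :: "nat \<Rightarrow> int"
    by (simp add: fun_eq_iff)
  ultimately show "fst e \<noteq> snd e"
    using zero_notin_grid_generators[of k] by metis
qed (auto simp: grid_def)

end

theory Submission
  imports Defs
begin

text \<open>
  Take a labeling \<open>f\<close> whose set of edge labels \<open>d\<^sub>0, \<dots>, d\<^sub>m\<^sub>-\<^sub>1\<close> has the least possible size
  \<open>m \<le> k\<close>, and give each label its own coordinate direction: while \<open>f\<close> changes by
  \<open>\<plusminus>d\<^sub>j\<close> along an arc, let a map \<open>h\<close> into the lattice change by the \<open>j\<close>-th unit vector with the
  same sign. The prescribed increments negate under arc reversal, and a tree has no cycle around
  which they could fail to add up to zero, so such an \<open>h\<close> exists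
  (\<open>tree_potential_exists\<close>, applied in each coordinate). By construction \<open>h\<close> sends edges to grid
  edges.

  Injectivity of \<open>h\<close> comes from injectivity of \<open>f\<close>: the linear functional
  \<open>x \<mapsto> \<Sum>j. d\<^sub>j x\<^sub>j\<close> composed with \<open>h\<close> has the same increments along arcs as \<open>f\<close>, so by
  connectedness it differs from \<open>f\<close> by a constant (\<open>equal_differences_imp_equal_offset\<close>), and
  \<open>h u = h v\<close> forces \<open>f u = f v\<close>. An injective map on vertices that sends edges to grid edges is
  an isomorphism onto a subgraph of the grid (\<open>embedding_into_grid\<close>).
\<close>

section \<open>Potentials on trees\<close>

lemma (in wf_digraph) awalk_leaves_set:
  assumes "awalk u p v" "u \<in> S" "v \<notin> S"
  shows "\<exists>e\<in>arcs G. tail G e \<in> S \<and> head G e \<notin> S"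
  using assms
proof (induction p arbitrary: u)
  case (Cons e p)
  then show ?case
    by (cases "head G e \<in> S") (auto simp: awalk_Cons_iff)
qed (auto simp: awalk_Nil_iff)

text \<open>
  Connectedness of the subgraph induced on \<open>S\<close>, stated with simple paths of the ambient graph
  because it is simple paths that close up to cycles.
\<close>

definition (in pre_digraph) apath_connected :: "'a set \<Rightarrow> bool" where
  "apath_connected S \<longleftrightarrow>
     (\<forall>u\<in>S. \<forall>v\<in>S. \<exists>p. apath u p v \<and> set (awalk_verts u p) \<subseteq> S)"

definition (in pre_digraph) potential_on :: "'a set \<Rightarrow> ('b \<Rightarrow> 'c::ab_group_add) \<Rightarrow> ('a \<Rightarrow> 'c) \<Rightarrow> bool" where
  "potential_on S w g \<longleftrightarrow>
     (\<forall>e\<in>arcs G. tail G e \<in> S \<longrightarrow> head G e \<in> S \<longrightarrow> g (head G e) - g (tail G e) = w e)"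

lemma (in sym_digraph) reverse_arc:
  assumes "e \<in> arcs G"
  obtains e' where "e' \<in> arcs G" "tail G e' = head G e" "head G e' = tail G e"
proof -
  have "(head G e, tail G e) \<in> arcs_ends G"
    by (rule graph_symmetric[OF in_arcs_imp_in_arcs_ends[OF assms]])
  then show thesis
    using that by (auto simp: arcs_ends_conv)
qed

text \<open>
  Two arcs from a connected set \<open>S\<close> to the same outside vertex would, together with a simple path
  in \<open>S\<close> between their tails, form a cycle.
\<close>

lemma (in graph) unique_arc_into_outside_vertex:
  assumes acyclic: "\<not> (\<exists>p. cycle p \<and> 3 \<le> length p)"
    and S: "apath_connected S"
    and e1: "e1 \<in> arcs G" "tail G e1 \<in> S"
    and e2: "e2 \<in> arcs G" "tail G e2 \<in> S"
    and same: "head G e1 = head G e2" and out: "head G e1 \<notin> S"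
  shows "e1 = e2"
proof -
  have "tail G e1 = tail G e2"
  proof (rule ccontr)
    assume ne: "tail G e1 \<noteq> tail G e2"
    obtain p where p: "apath (tail G e1) p (tail G e2)"
      "set (awalk_verts (tail G e1) p) \<subseteq> S"
      using S e1 e2 unfolding apath_connected_def by blast
    obtain e' where e': "e' \<in> arcs G" "tail G e' = head G e1" "head G e' = tail G e1"
      using e1(1) by (rule reverse_arc)
    \<comment> \<open>From the outside vertex back along the first arc, through \<open>S\<close>, and out along the second.\<close>
    let ?v = "head G e1" and ?c = "e' # p @ [e2]"
    have aw: "awalk (tail G e1) p (tail G e2)" and d: "distinct (awalk_verts (tail G e1) p)"
      using p(1) by (auto simp: apath_def)
    have aw2: "awalk (tail G e1) (p @ [e2]) ?v"
      using awalk_appendI[OF aw arc_implies_awalk[OF e2(1)]] same by simp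
    have "awalk ?v ?c ?v"
      using aw2 e' by (simp only: awalk_Cons_iff simp_thms)
    moreover have "tl (awalk_verts ?v ?c) = awalk_verts (tail G e1) p @ [?v]"
      using awalk_verts_append[OF aw2] aw e' same by simp
    then have "distinct (tl (awalk_verts ?v ?c))"
      using d p(2) out by auto
    ultimately have "cycle ?c"
      unfolding cycle_def by blast
    moreover have "p \<noteq> []"
      using aw ne by (auto simp: awalk_Nil_iff)
    then have "3 \<le> length ?c"
      by (cases p) auto
    ultimately show False
      using acyclic by blast
  qed
  then show ?thesis
    using no_multi_arcs[OF e1(1) e2(1)] same by (simp add: arc_to_ends_def)
qed

lemma (in graph) apath_connected_insert:
  assumes S: "apath_connected S" and e: "e \<in> arcs G" "tail G e \<in> S" "head G e \<notin> S"
  shows "apath_connected (insert (head G e) S)"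
proof -
  let ?v = "head G e"
  obtain e' where e': "e' \<in> arcs G" "tail G e' = ?v" "head G e' = tail G e"
    using e(1) by (rule reverse_arc)
  have to_v: "\<exists>p. apath a p ?v \<and> set (awalk_verts a p) \<subseteq> insert ?v S" if a: "a \<in> S" for a
  proof -
    obtain p where p: "apath a p (tail G e)" "set (awalk_verts a p) \<subseteq> S"
      using S a e unfolding apath_connected_def by blast
    then have aw: "awalk a p (tail G e)"
      by (simp add: apath_def)
    have aw2: "awalk a (p @ [e]) ?v"
      using awalk_appendI[OF aw arc_implies_awalk[OF e(1)]] .
    have vs: "awalk_verts a (p @ [e]) = awalk_verts a p @ [?v]"
      using awalk_verts_append[OF aw2] by simp
    have "apath a (p @ [e]) ?v"
      using aw2 p e(3) unfolding apath_def vs by auto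
    moreover have "set (awalk_verts a (p @ [e])) \<subseteq> insert ?v S"
      using p(2) unfolding vs by auto
    ultimately show ?thesis by blast
  qed
  have from_v: "\<exists>p. apath ?v p a \<and> set (awalk_verts ?v p) \<subseteq> insert ?v S" if a: "a \<in> S" for a
  proof -
    obtain p where p: "apath (tail G e) p a" "set (awalk_verts (tail G e) p) \<subseteq> S"
      using S a e unfolding apath_connected_def by blast
    then have "apath ?v (e' # p) a" "set (awalk_verts ?v (e' # p)) \<subseteq> insert ?v S"
      using e' e(3) by (auto simp: apath_Cons_iff)
    then show ?thesis by blast
  qed
  have stay: "\<exists>p. apath ?v p ?v \<and> set (awalk_verts ?v p) \<subseteq> insert ?v S"
    using e(1) by (intro exI[of _ "[]"]) (simp add: apath_Nil_iff)
  have old: "\<exists>p. apath a p b \<and> set (awalk_verts a p) \<subseteq> insert ?v S"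
    if "a \<in> S" "b \<in> S" for a b
    using S that unfolding apath_connected_def by blast
  show ?thesis
    using to_v from_v stay old unfolding apath_connected_def ball_simps by simp
qed

text \<open>
  The value at the new vertex is dictated by one arc. It satisfies all constraints because that
  arc and its reverse are the only ones between the new vertex and \<open>S\<close>.
\<close>

lemma (in graph) potential_on_insert:
  assumes acyclic: "\<not> (\<exists>p. cycle p \<and> 3 \<le> length p)"
    and S: "apath_connected S" and g: "potential_on S w g"
    and e: "e \<in> arcs G" "tail G e \<in> S" "head G e \<notin> S"
    and anti: "\<And>a b. \<lbrakk>a \<in> arcs G; b \<in> arcs G; tail G b = head G a; head G b = tail G a\<rbrakk>
      \<Longrightarrow> w b = - w a"
  shows "potential_on (insert (head G e) S) w (g(head G e := g (tail G e) + w e))"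
  unfolding potential_on_def
proof (intro ballI impI)
  fix a assume a: "a \<in> arcs G" and ends: "tail G a \<in> insert (head G e) S" "head G a \<in> insert (head G e) S"
  let ?v = "head G e" and ?g = "g(head G e := g (tail G e) + w e)"
  consider (old) "tail G a \<in> S" "head G a \<in> S" | (into) "tail G a \<in> S" "head G a = ?v"
    | (out) "tail G a = ?v" "head G a \<in> S"
    using ends no_loops[OF a] by auto
  then show "?g (head G a) - ?g (tail G a) = w a"
  proof cases
    case old
    then show ?thesis
      using g a e(3) unfolding potential_on_def by auto
  next
    case into
    then have "a = e"
      using unique_arc_into_outside_vertex[OF acyclic S a _ e(1,2)] e(3) by simp
    then show ?thesis
      using e by auto
  next
    case out
    obtain b where b: "b \<in> arcs G" "tail G b = head G a" "head G b = tail G a"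
      using a by (rule reverse_arc)
    then have "b = e"
      using unique_arc_into_outside_vertex[OF acyclic S b(1) _ e(1,2)] e(3) out by simp
    then show ?thesis
      using out b anti[OF b(1) a] e by auto
  qed
qed

text \<open>
  On a tree every antisymmetric arc weight is the discrete gradient of a vertex function. The
  function is built by growing a connected set of vertices one at a time; connectedness of the
  tree supplies an arc out of the set as long as it is not everything.
\<close>

lemma tree_potential_exists:
  fixes w :: "'b \<Rightarrow> 'c::ab_group_add"
  assumes tree: "undirected_tree G"
    and anti: "\<And>a b. \<lbrakk>a \<in> arcs G; b \<in> arcs G; tail G b = head G a; head G b = tail G a\<rbrakk>
      \<Longrightarrow> w b = - w a"
  shows "\<exists>g. \<forall>e\<in>arcs G. g (head G e) - g (tail G e) = w e"
proof -
  interpret graph G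
    using tree by (simp add: undirected_tree_def)
  have acyclic: "\<not> (\<exists>p. cycle p \<and> 3 \<le> length p)" and conn: "connected G"
    using tree by (auto simp: undirected_tree_def)
  have sc: "strongly_connected G"
    using sym_arcs conn by (rule symmetric_connected_imp_strongly_connected)
  have "\<exists>S g. S \<subseteq> verts G \<and> card S = Suc n \<and> apath_connected S \<and> potential_on S w g"
    if "n < card (verts G)" for n
    using that
  proof (induction n)
    case 0
    then obtain r where r: "r \<in> verts G"
      by (metis card.empty ex_in_conv less_irrefl)
    have "apath_connected {r}"
      unfolding apath_connected_def using r by (auto intro!: exI[of _ "[]"] simp: apath_Nil_iff)
    moreover have "potential_on {r} w (\<lambda>_. 0)"
      unfolding potential_on_def using no_loops by (metis singletonD)
    ultimately show ?case
      using r by (intro exI[of _ "{r}"] exI[of _ "\<lambda>_. 0"]) simp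
  next
    case (Suc n)
    then obtain S g where S: "S \<subseteq> verts G" "card S = Suc n" "apath_connected S" "potential_on S w g"
      by auto
    obtain u where u: "u \<in> S"
      using S(2) by fastforce
    obtain v where v: "v \<in> verts G" "v \<notin> S"
      using S(1,2) Suc.prems by (metis less_irrefl subset_antisym subsetI)
    have "u \<rightarrow>\<^sup>*\<^bsub>G\<^esub> v"
      using sc u v S(1) unfolding strongly_connected_def by blast
    then obtain e where e: "e \<in> arcs G" "tail G e \<in> S" "head G e \<notin> S"
      using awalk_leaves_set[OF _ u v(2)] unfolding reachable_awalk by blast
    let ?S = "insert (head G e) S"
    have "finite S"
      using S(2) by (metis card.infinite nat.distinct(1))
    then have "?S \<subseteq> verts G" "card ?S = Suc (Suc n)"
      using S e by auto
    moreover have "apath_connected ?S"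
      using S(3) e by (rule apath_connected_insert)
    moreover have "potential_on ?S w (g(head G e := g (tail G e) + w e))"
      using acyclic S(3,4) e anti by (rule potential_on_insert)
    ultimately show ?case by blast
  qed
  moreover have "card (verts G) > 0"
    using sc by (auto simp: strongly_connected_def card_gt_0_iff)
  ultimately obtain S g where S: "S \<subseteq> verts G" "card S = card (verts G)" "potential_on S w g"
    by (metis Suc_diff_1 diff_less zero_less_one)
  then have "S = verts G"
    by (intro card_subset_eq) auto
  then show ?thesis
    using S(3) unfolding potential_on_def by auto
qed

lemma (in graph) equal_differences_imp_equal_offset:
  fixes f h :: "'a \<Rightarrow> 'c::ab_group_add"
  assumes conn: "connected G"
    and diff: "\<And>e. e \<in> arcs G \<Longrightarrow> f (head G e) - f (tail G e) = h (head G e) - h (tail G e)"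
    and uv: "u \<in> verts G" "v \<in> verts G"
  shows "f v - f u = h v - h u"
proof -
  have "u \<rightarrow>\<^sup>* v"
    using symmetric_connected_imp_strongly_connected[OF sym_arcs conn] uv
    unfolding strongly_connected_def by blast
  then obtain p where "awalk u p v"
    unfolding reachable_awalk by blast
  then show ?thesis
  proof (induction p arbitrary: u)
    case Nil
    then show ?case by (simp add: awalk_Nil_iff)
  next
    case (Cons e p)
    then have e: "e \<in> arcs G" and u: "u = tail G e"
      and IH: "f v - f (head G e) = h v - h (head G e)"
      by (auto simp: awalk_Cons_iff)
    have "f v - f u = (f v - f (head G e)) + (f (head G e) - f (tail G e))"
      using u by simp
    also have "\<dots> = (h v - h (head G e)) + (h (head G e) - h (tail G e))"
      by (simp only: IH diff[OF e])
    also have "\<dots> = h v - h u"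
      using u by simp
    finally show ?case .
  qed
qed

section \<open>The embedding\<close>

text \<open>
  The minimum defining the index is over a nonempty set: a finite vertex set can be numbered
  injectively, and an arc makes the number of labels positive.
\<close>

lemma difference_index_attained:
  assumes "graph G" "arcs G \<noteq> {}"
  shows "\<exists>f. vertex_labeling G f \<and> card (edge_labeling G f ` arcs G) = difference_index G"
proof -
  interpret graph G by fact
  obtain h :: "'a \<Rightarrow> nat" where h: "inj_on h (verts G)"
    using finite_verts finite_imp_inj_to_nat_seg by metis
  let ?f = "int \<circ> h"
  have "vertex_labeling G ?f"
    unfolding vertex_labeling_def using h by (simp add: comp_inj_on)
  moreover have "0 < card (edge_labeling G ?f ` arcs G)"
    using assms(2) by (simp add: card_gt_0_iff)
  ultimately have "\<exists>k. 0 < k \<and> (\<exists>f. vertex_labeling G f \<and> card (edge_labeling G f ` arcs G) = k)"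
    by blast
  from LeastI_ex[OF this] show ?thesis
    unfolding difference_index_def by blast
qed

text \<open>
  The image of \<open>G\<close> takes as its arcs the pairs of image vertices, so that it shares the end
  functions \<open>fst\<close> and \<open>snd\<close> with the grid, as \<^const>\<open>subgraph\<close> demands. Sending arcs to such pairs
  is injective because \<open>G\<close> has no parallel arcs.
\<close>

lemma embedding_into_grid:
  assumes "graph G" and inj: "inj_on g (verts G)" and lat: "g ` verts G \<subseteq> lattice k"
    and step: "\<And>e. e \<in> arcs G \<Longrightarrow> g (tail G e) - g (head G e) \<in> grid_generators k"
  shows "\<exists>H. subgraph H (with_proj (grid k)) \<and> graph H \<and> digraph_iso G H"
proof -
  interpret graph G by fact
  define hom where "hom = \<lparr> iso_verts = g, iso_arcs = (\<lambda>e. (g (tail G e), g (head G e))),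
    iso_head = snd, iso_tail = fst \<rparr>"
  let ?H = "app_iso hom G"
  have "inj_on (\<lambda>e. (g (tail G e), g (head G e))) (arcs G)"
  proof (rule inj_onI)
    fix a b assume ab: "a \<in> arcs G" "b \<in> arcs G"
      "(g (tail G a), g (head G a)) = (g (tail G b), g (head G b))"
    then show "a = b"
      using inj_onD[OF inj] no_multi_arcs[OF ab(1,2)] by (simp add: arc_to_ends_def)
  qed
  then have hom: "digraph_isomorphism hom"
    unfolding digraph_isomorphism_def using inj wf_digraph by (auto simp: hom_def)
  interpret H: fin_digraph ?H
    using hom ..
  interpret grid: pair_bidirected_digraph "grid k"
    by (rule pair_bidirected_digraph_grid)
  have graph_H: "graph ?H"
  proof
    fix a assume "a \<in> arcs ?H"
    then show "tail ?H a \<noteq> head ?H a"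
      using no_loops inj_onD[OF inj] by (fastforce simp: hom_def)
  next
    fix a b assume "arc_to_ends ?H a = arc_to_ends ?H b"
    then show "a = b"
      by (simp add: hom_def arc_to_ends_def prod_eq_iff)
  next
    show "symmetric ?H"
      using graph_symmetric
      unfolding symmetric_def arcs_ends_app_iso_eq[OF hom] sym_def by auto
  qed
  have "subgraph ?H (with_proj (grid k))"
    unfolding subgraph_def compatible_def
    using lat step grid.wf_digraph H.wf_digraph
    by (auto simp: hom_def grid_def)
  with graph_H hom show ?thesis
    unfolding digraph_iso_def by blast
qed

theorem theorem3p16:
  fixes G :: "('a, 'b) pre_digraph" and k :: nat
  assumes "0 < k"
    and "undirected_tree G"
    and "arcs G \<noteq> {}"
    and "difference_index G \<le> k"
  shows "\<exists>H. subgraph H (with_proj (grid k)) \<and> graph H \<and> digraph_iso G H"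
proof -
  interpret graph G
    using assms(2) by (simp add: undirected_tree_def)
  obtain f where f: "inj_on f (verts G)" and card: "card (edge_labeling G f ` arcs G) \<le> k"
    using difference_index_attained[OF graph_axioms assms(3)] assms(4)
    unfolding vertex_labeling_def by metis
  let ?L = "edge_labeling G f ` arcs G"
  have "finite ?L" by simp
  then obtain idx where idx: "bij_betw idx ?L {..<card ?L}"
    using ex_bij_betw_finite_nat atLeast0LessThan by metis
  \<comment> \<open>\<open>c e\<close> is the coordinate direction assigned to the label of \<open>e\<close>, and \<open>d\<close> recovers the label.\<close>
  define c where "c e = idx (edge_labeling G f e)" for e
  define d where "d = the_inv_into ?L idx"
  have c: "c e < k" "d (c e) = edge_labeling G f e" if "e \<in> arcs G" for e
  proof -
    have "c e \<in> {..<card ?L}"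
      using that unfolding c_def by (intro bij_betwE[OF idx, rule_format]) simp
    then show "c e < k"
      using card by simp
    show "d (c e) = edge_labeling G f e"
      using idx that unfolding c_def d_def bij_betw_def by (auto intro: the_inv_into_f_f)
  qed
  define s where "s e = sgn (f (head G e) - f (tail G e))" for e
  have s: "s e = 1 \<or> s e = -1" "d (c e) * s e = f (head G e) - f (tail G e)" if "e \<in> arcs G" for e
  proof -
    have "f (head G e) \<noteq> f (tail G e)"
      using inj_onD[OF f] no_loops[OF that] that by (metis head_in_verts tail_in_verts)
    then show "s e = 1 \<or> s e = -1"
      by (auto simp: s_def sgn_if)
    show "d (c e) * s e = f (head G e) - f (tail G e)"
      using c(2)[OF that] by (simp add: edge_labeling_def s_def abs_minus_commute abs_mult_sgn)
  qed
  have "\<exists>g. \<forall>e\<in>arcs G. g (head G e) - g (tail G e) = (if c e = j then s e else 0)" for j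
  proof (rule tree_potential_exists[OF assms(2)])
    fix a b assume "tail G b = head G a" "head G b = tail G a"
    then have "c b = c a" "s b = - s a"
      by (simp_all add: c_def s_def edge_labeling_def abs_minus_commute sgn_if)
    then show "(if c b = j then s b else 0) = - (if c a = j then s a else 0)"
      by simp
  qed
  then obtain g where g: "\<And>j e. e \<in> arcs G \<Longrightarrow>
      g j (head G e) - g j (tail G e) = (if c e = j then s e else 0)"
    by metis
  define h where "h v = (\<lambda>j. if j < k then g j v else 0)" for v
  have "inj_on h (verts G)"
  proof (rule inj_onI)
    fix u v assume uv: "u \<in> verts G" "v \<in> verts G" and eq: "h u = h v"
    let ?F = "\<lambda>v. \<Sum>j<k. d j * g j v"
    \<comment> \<open>Weighting each coordinate by its label turns the unit steps of \<open>g\<close> back into those of \<open>f\<close>.\<close>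
    have "?F v - ?F u = f v - f u"
    proof (rule equal_differences_imp_equal_offset[OF _ _ uv])
      show "connected G"
        using assms(2) by (simp add: undirected_tree_def)
      fix e assume e: "e \<in> arcs G"
      have "?F (head G e) - ?F (tail G e) = (\<Sum>j<k. d j * (if c e = j then s e else 0))"
        using g[OF e] by (simp flip: sum_subtractf right_diff_distrib)
      also have "\<dots> = d (c e) * s e"
        using c(1)[OF e] by (simp add: if_distrib cong: if_cong)
      finally show "?F (head G e) - ?F (tail G e) = f (head G e) - f (tail G e)"
        using s(2)[OF e] by simp
    qed
    moreover have "g j u = g j v" if "j < k" for j
      using fun_cong[OF eq, of j] that by (simp add: h_def)
    then have "?F v = ?F u"
      by simp
    ultimately have "f u = f v"
      by simp
    then show "u = v"
      using f uv by (auto dest: inj_onD)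
  qed
  moreover have "h ` verts G \<subseteq> lattice k"
    by (auto simp: h_def lattice_def)
  moreover have "h (tail G e) - h (head G e) \<in> grid_generators k" if e: "e \<in> arcs G" for e
  proof -
    have "h (tail G e) j - h (head G e) j = (if j = c e then - s e else 0)" for j
      using g[OF e, of j] c(1)[OF e] by (auto simp: h_def split: if_splits)
    then have "h (tail G e) - h (head G e) = (\<lambda>j. if j = c e then - s e else 0)"
      by (simp add: fun_eq_iff)
    then have "h (tail G e) - h (head G e) = unit_vec (c e) \<or>
        h (tail G e) - h (head G e) = - unit_vec (c e)"
      using s(1)[OF e] by (auto simp: unit_vec_def fun_eq_iff)
    then show ?thesis
      using c(1)[OF e] unfolding grid_generators_def by auto
  qed
  ultimately show ?thesis
    by (rule embedding_into_grid[OF graph_axioms])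
qed

end
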